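(* Let $\zeta,T\in\mathbb N$. Define $$f:\mathbb R^\zeta\times\mathbb R^T\times\bigcup_{t=1}^T[\zeta]^t\to\mathbb R,\qquad(z,u,\alpha)\mapsto\sum_{t=1}^{|\alpha|}u_tz_{\alpha_t}.$$ Then, for generic $(z,u)\in\mathbb R^\zeta\times\mathbb R^T$, the map $f(z,u,\cdot)$ is an injective map from $\bigcup_{t=1}^T[\zeta]^t$ into $\mathbb R\setminus\{0\}$.
   Context: $[\zeta]=\{1,\ldots,\zeta\}$; $|\alpha|$ is the length of the sequence $\alpha$. A property holds for generic points if the set of exceptions is contained in the zero set of a real analytic function (here on $\mathbb R^\zeta\times\mathbb R^T$) that is not identically zero. *)

theory Defs
  imports "HOL-Analysis.Analysis"
begin

text \<open>The dimensions are natural numbers, possibly zero, so a point of \<open>n\<close>-space is an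
  extensional function on \<open>{1..n}\<close>.\<close>

definition coord_space :: "nat \<Rightarrow> (nat \<Rightarrow> real) set" where
  "coord_space n = ({1..n} \<rightarrow>\<^sub>E (UNIV :: real set))"

definition multi_indices :: "nat \<Rightarrow> (nat \<Rightarrow> nat) set" where
  "multi_indices n = ({1..n} \<rightarrow>\<^sub>E (UNIV :: nat set))"

definition monomial_at :: "nat \<Rightarrow> (nat \<Rightarrow> real) \<Rightarrow> (nat \<Rightarrow> nat) \<Rightarrow> (nat \<Rightarrow> real) \<Rightarrow> real" where
  "monomial_at n a k x = (\<Prod>i=1..n. (x i - a i) ^ k i)"

text \<open>Real analyticity on the whole of the product of \<open>m\<close>-space and \<open>n\<close>-space: around every point
  the function is the sum of a power series in the \<open>m + n\<close> coordinates. The neighbourhoods are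
  balls of the maximum norm, and \<open>has_sum\<close> makes the convergence unconditional, that is,
  absolute.\<close>

definition real_analytic2 ::
    "nat \<Rightarrow> nat \<Rightarrow> ((nat \<Rightarrow> real) \<times> (nat \<Rightarrow> real) \<Rightarrow> real) \<Rightarrow> bool" where
  "real_analytic2 m n g \<longleftrightarrow>
    (\<forall>a \<in> coord_space m. \<forall>b \<in> coord_space n.
      \<exists>r > 0. \<exists>c :: (nat \<Rightarrow> nat) \<Rightarrow> (nat \<Rightarrow> nat) \<Rightarrow> real.
        \<forall>z \<in> coord_space m. \<forall>u \<in> coord_space n.
          (\<forall>i \<in> {1..m}. \<bar>z i - a i\<bar> < r) \<longrightarrow> (\<forall>j \<in> {1..n}. \<bar>u j - b j\<bar> < r) \<longrightarrow>
          ((\<lambda>(k, l). c k l * monomial_at m a k z * monomial_at n b l u) has_sum g (z, u))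
            (multi_indices m \<times> multi_indices n))"

definition generic2 ::
    "nat \<Rightarrow> nat \<Rightarrow> ((nat \<Rightarrow> real) \<Rightarrow> (nat \<Rightarrow> real) \<Rightarrow> bool) \<Rightarrow> bool" where
  "generic2 m n P \<longleftrightarrow>
    (\<exists>g. real_analytic2 m n g \<and>
      (\<exists>p \<in> coord_space m \<times> coord_space n. g p \<noteq> 0) \<and>
      {(z, u) \<in> coord_space m \<times> coord_space n. \<not> P z u}
        \<subseteq> {p \<in> coord_space m \<times> coord_space n. g p = 0})"

definition words :: "nat \<Rightarrow> nat \<Rightarrow> nat list set" where
  "words \<zeta> T = (\<Union>t \<in> {1..T}. {\<alpha>. length \<alpha> = t \<and> set \<alpha> \<subseteq> {1..\<zeta>}})"

text \<open>Lists are indexed from 0, so the \<open>t\<close>-th letter of \<open>\<alpha>\<close> is \<open>\<alpha> ! (t - 1)\<close>.\<close>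

definition word_sum :: "(nat \<Rightarrow> real) \<Rightarrow> (nat \<Rightarrow> real) \<Rightarrow> nat list \<Rightarrow> real" where
  "word_sum z u \<alpha> = (\<Sum>t = 1..length \<alpha>. u t * z (\<alpha> ! (t - 1)))"

end

theory Submission
  imports Defs
begin

text \<open>The exceptional set is the zero set of the product of all the polynomials
  \<open>word_sum z u \<alpha>\<close> and \<open>word_sum z u \<alpha> - word_sum z u \<beta>\<close> with \<open>\<alpha> \<noteq> \<beta>\<close>. None of the factors
  vanishes at the point \<open>z i = i\<close>, \<open>u t = (\<zeta> + 1) ^ (t - 1)\<close>, because there
  \<open>word_sum\<close> reads a word as a numeral in base \<open>\<zeta> + 1\<close> whose digits are all nonzero.\<close>

text \<open>The expansion uses the monomials centred at \<open>(a, b)\<close> that occur in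
  \<open>real_analytic2\<close>, so that it can serve there as the power series. Values of
  \<open>g\<close> off the coordinate spaces are left free.\<close>

definition polynomial_at ::
    "nat \<Rightarrow> nat \<Rightarrow> (nat \<Rightarrow> real) \<Rightarrow> (nat \<Rightarrow> real) \<Rightarrow> ((nat \<Rightarrow> real) \<times> (nat \<Rightarrow> real) \<Rightarrow> real) \<Rightarrow> bool"
  where "polynomial_at m n a b g \<longleftrightarrow>
    (\<exists>S c. finite S \<and> S \<subseteq> multi_indices m \<times> multi_indices n \<and>
      (\<forall>z \<in> coord_space m. \<forall>u \<in> coord_space n.
        g (z, u) = (\<Sum>p\<in>S. c p * (monomial_at m a (fst p) z * monomial_at n b (snd p) u))))"

text \<open>Terms with the same exponents \<open>K i\<close> are merged by adding their weights.
  Sums and products of polynomials can thus be given as families in which a monomial occurs several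
  times.\<close>

lemma polynomial_atI:
  fixes w :: "'i \<Rightarrow> real"
  assumes "finite I" and K: "K ` I \<subseteq> multi_indices m \<times> multi_indices n"
    and g: "\<And>z u. z \<in> coord_space m \<Longrightarrow> u \<in> coord_space n \<Longrightarrow>
      g (z, u) = (\<Sum>i\<in>I. w i * (monomial_at m a (fst (K i)) z * monomial_at n b (snd (K i)) u))"
  shows "polynomial_at m n a b g"
  unfolding polynomial_at_def
proof (intro exI conjI ballI)
  show "finite (K ` I)" using \<open>finite I\<close> by simp
  show "K ` I \<subseteq> multi_indices m \<times> multi_indices n" by fact
  fix z u assume zu: "z \<in> coord_space m" "u \<in> coord_space n"
  let ?M = "\<lambda>p. monomial_at m a (fst p) z * monomial_at n b (snd p) u"
  have "g (z, u) = (\<Sum>i\<in>I. w i * ?M (K i))" by (rule g[OF zu])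
  also have "\<dots> = (\<Sum>p\<in>K ` I. \<Sum>i\<in>{i \<in> I. K i = p}. w i * ?M (K i))"
    by (rule sum.image_gen[OF \<open>finite I\<close>])
  also have "\<dots> = (\<Sum>p\<in>K ` I. (\<Sum>i\<in>{i \<in> I. K i = p}. w i) * ?M p)"
    by (simp add: sum_distrib_right)
  finally show "g (z, u) = (\<Sum>p\<in>K ` I. (\<Sum>i\<in>{i \<in> I. K i = p}. w i) * ?M p)" .
qed

lemma polynomial_atE:
  assumes "polynomial_at m n a b g"
  obtains S c where "finite S" "S \<subseteq> multi_indices m \<times> multi_indices n"
    "\<And>z u. z \<in> coord_space m \<Longrightarrow> u \<in> coord_space n \<Longrightarrow>
      g (z, u) = (\<Sum>p\<in>S. c p * (monomial_at m a (fst p) z * monomial_at n b (snd p) u))"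
  using assms unfolding polynomial_at_def by blast

text \<open>The zero exponent is a restricted function because members of
  \<open>multi_indices n\<close> are extensional.\<close>

lemma monomial_at_zero: "monomial_at n a (\<lambda>i\<in>{1..n}. 0) x = 1"
  by (simp add: monomial_at_def)

lemma monomial_at_unit:
  assumes "i \<in> {1..n}"
  shows "monomial_at n a (\<lambda>j\<in>{1..n}. of_bool (j = i)) x = x i - a i"
proof -
  have "monomial_at n a (\<lambda>j\<in>{1..n}. of_bool (j = i)) x
      = (\<Prod>j=1..n. if j = i then x j - a j else 1)"
    unfolding monomial_at_def by (intro prod.cong) auto
  with assms show ?thesis by simp
qed

lemma monomial_at_add:
  "monomial_at n a (\<lambda>i\<in>{1..n}. k i + l i) x = monomial_at n a k x * monomial_at n a l x"
  by (simp add: monomial_at_def power_add prod.distrib)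

lemma restrict_in_multi_indices [simp]: "restrict k {1..n} \<in> multi_indices n"
  by (simp add: multi_indices_def)

lemma polynomial_at_const: "polynomial_at m n a b (\<lambda>_. r)"
  by (rule polynomial_atI[of "{()}" "\<lambda>_. (\<lambda>i\<in>{1..m}. 0, \<lambda>i\<in>{1..n}. 0)" _ _ _ "\<lambda>_. r"])
    (simp_all add: monomial_at_zero del: One_nat_def)

lemma polynomial_at_add:
  assumes "polynomial_at m n a b g" "polynomial_at m n a b h"
  shows "polynomial_at m n a b (\<lambda>p. g p + h p)"
proof -
  obtain S c where S: "finite S" "S \<subseteq> multi_indices m \<times> multi_indices n"
    "\<And>z u. z \<in> coord_space m \<Longrightarrow> u \<in> coord_space n \<Longrightarrow>
      g (z, u) = (\<Sum>p\<in>S. c p * (monomial_at m a (fst p) z * monomial_at n b (snd p) u))"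
    using assms(1) by (elim polynomial_atE) blast
  obtain S' c' where S': "finite S'" "S' \<subseteq> multi_indices m \<times> multi_indices n"
    "\<And>z u. z \<in> coord_space m \<Longrightarrow> u \<in> coord_space n \<Longrightarrow>
      h (z, u) = (\<Sum>p\<in>S'. c' p * (monomial_at m a (fst p) z * monomial_at n b (snd p) u))"
    using assms(2) by (elim polynomial_atE) blast
  \<comment> \<open>The disjoint sum \<open>S <+> S'\<close> keeps the two expansions apart even if
    they share monomials.\<close>
  show ?thesis
    by (rule polynomial_atI[of "S <+> S'" "case_sum id id" _ _ _ "case_sum c c'"])
      (use S S' in \<open>auto simp: sum.Plus\<close>)
qed

lemma polynomial_at_mult:
  assumes "polynomial_at m n a b g" "polynomial_at m n a b h"
  shows "polynomial_at m n a b (\<lambda>p. g p * h p)"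
proof -
  obtain S c where S: "finite S" "S \<subseteq> multi_indices m \<times> multi_indices n"
    "\<And>z u. z \<in> coord_space m \<Longrightarrow> u \<in> coord_space n \<Longrightarrow>
      g (z, u) = (\<Sum>p\<in>S. c p * (monomial_at m a (fst p) z * monomial_at n b (snd p) u))"
    using assms(1) by (elim polynomial_atE) blast
  obtain S' c' where S': "finite S'" "S' \<subseteq> multi_indices m \<times> multi_indices n"
    "\<And>z u. z \<in> coord_space m \<Longrightarrow> u \<in> coord_space n \<Longrightarrow>
      h (z, u) = (\<Sum>p\<in>S'. c' p * (monomial_at m a (fst p) z * monomial_at n b (snd p) u))"
    using assms(2) by (elim polynomial_atE) blast
  \<comment> \<open>Multiplying out gives one term for each pair: coefficients multiply and
    exponents add.\<close>
  show ?thesis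
  proof (rule polynomial_atI[where I = "S \<times> S'" and w = "\<lambda>(p, q). c p * c' q" and
        K = "\<lambda>(p, q). (\<lambda>i\<in>{1..m}. fst p i + fst q i, \<lambda>j\<in>{1..n}. snd p j + snd q j)"])
    show "finite (S \<times> S')" using S(1) S'(1) by simp
    show "(\<lambda>(p, q). (\<lambda>i\<in>{1..m}. fst p i + fst q i, \<lambda>j\<in>{1..n}. snd p j + snd q j)) ` (S \<times> S')
        \<subseteq> multi_indices m \<times> multi_indices n"
      by (auto simp del: One_nat_def)
    fix z u assume zu: "z \<in> coord_space m" "u \<in> coord_space n"
    show "g (z, u) * h (z, u) = (\<Sum>i\<in>S \<times> S'. (case i of (p, q) \<Rightarrow> c p * c' q) *
        (monomial_at m a (fst (case i of (p, q) \<Rightarrow>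
            (\<lambda>i\<in>{1..m}. fst p i + fst q i, \<lambda>j\<in>{1..n}. snd p j + snd q j))) z *
         monomial_at n b (snd (case i of (p, q) \<Rightarrow>
            (\<lambda>i\<in>{1..m}. fst p i + fst q i, \<lambda>j\<in>{1..n}. snd p j + snd q j))) u))"
      unfolding S(3)[OF zu] S'(3)[OF zu] sum_product sum.cartesian_product
      by (intro sum.cong) (auto simp: monomial_at_add simp del: One_nat_def)
  qed
qed

lemma polynomial_at_diff:
  assumes "polynomial_at m n a b g" "polynomial_at m n a b h"
  shows "polynomial_at m n a b (\<lambda>p. g p - h p)"
  using polynomial_at_add[OF assms(1) polynomial_at_mult[OF polynomial_at_const[of m n a b "-1"] assms(2)]]
  by simp

lemma polynomial_at_fst:
  assumes "i \<in> {1..m}"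
  shows "polynomial_at m n a b (\<lambda>p. fst p i)"
proof -
  \<comment> \<open>The displacement from the centre is itself a monomial; the constant
    \<open>a i\<close> is added back afterwards.\<close>
  have "polynomial_at m n a b (\<lambda>p. fst p i - a i)"
    by (rule polynomial_atI[of "{()}"
          "\<lambda>_. (\<lambda>j\<in>{1..m}. of_bool (j = i), \<lambda>j\<in>{1..n}. 0)" _ _ _ "\<lambda>_. 1"])
      (simp_all add: monomial_at_zero monomial_at_unit[OF assms] del: One_nat_def)
  from polynomial_at_add[OF this polynomial_at_const[of m n a b "a i"]] show ?thesis by simp
qed

lemma polynomial_at_snd:
  assumes "j \<in> {1..n}"
  shows "polynomial_at m n a b (\<lambda>p. snd p j)"
proof -
  have "polynomial_at m n a b (\<lambda>p. snd p j - b j)"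
    by (rule polynomial_atI[of "{()}"
          "\<lambda>_. (\<lambda>i\<in>{1..m}. 0, \<lambda>i\<in>{1..n}. of_bool (i = j))" _ _ _ "\<lambda>_. 1"])
      (simp_all add: monomial_at_zero monomial_at_unit[OF assms] del: One_nat_def)
  from polynomial_at_add[OF this polynomial_at_const[of m n a b "b j"]] show ?thesis by simp
qed

lemma polynomial_at_sum:
  assumes "\<And>i. i \<in> I \<Longrightarrow> polynomial_at m n a b (g i)"
  shows "polynomial_at m n a b (\<lambda>p. \<Sum>i\<in>I. g i p)"
  using assms by (induction I rule: infinite_finite_induct)
    (simp_all add: polynomial_at_const polynomial_at_add)

lemma polynomial_at_prod:
  assumes "\<And>i. i \<in> I \<Longrightarrow> polynomial_at m n a b (g i)"
  shows "polynomial_at m n a b (\<lambda>p. \<Prod>i\<in>I. g i p)"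
  using assms by (induction I rule: infinite_finite_induct)
    (simp_all add: polynomial_at_const polynomial_at_mult)

text \<open>Re-expanded at any centre, a polynomial is its own power series, with finitely many
  nonzero coefficients.\<close>

lemma real_analytic2_if_polynomial:
  assumes "\<And>a b. polynomial_at m n a b g"
  shows "real_analytic2 m n g"
  unfolding real_analytic2_def
proof (intro ballI)
  fix a b
  obtain S c where S: "finite S" "S \<subseteq> multi_indices m \<times> multi_indices n"
    "\<And>z u. z \<in> coord_space m \<Longrightarrow> u \<in> coord_space n \<Longrightarrow>
      g (z, u) = (\<Sum>p\<in>S. c p * (monomial_at m a (fst p) z * monomial_at n b (snd p) u))"
    using assms[of a b] by (elim polynomial_atE) blast
  let ?d = "\<lambda>k l. if (k, l) \<in> S then c (k, l) else 0"
  have "((\<lambda>(k, l). ?d k l * monomial_at m a k z * monomial_at n b l u) has_sum g (z, u))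
      (multi_indices m \<times> multi_indices n)" if "z \<in> coord_space m" "u \<in> coord_space n" for z u
  proof -
    let ?f = "\<lambda>(k, l). ?d k l * monomial_at m a k z * monomial_at n b l u"
    have "sum ?f S = g (z, u)"
      unfolding S(3)[OF that] by (intro sum.cong) (auto simp: mult.assoc)
    then have "(?f has_sum g (z, u)) S"
      using has_sum_finite[OF S(1), of ?f] by simp
    \<comment> \<open>Outside \<open>S\<close> the coefficients \<open>?d\<close> are zero, so the
      finite sum is also the sum over all multi-indices.\<close>
    then show ?thesis
      by (rule iffD1[OF has_sum_cong_neutral, rotated -1]) (use S(2) in auto)
  qed
  then show "\<exists>r > 0. \<exists>c :: (nat \<Rightarrow> nat) \<Rightarrow> (nat \<Rightarrow> nat) \<Rightarrow> real.
        \<forall>z \<in> coord_space m. \<forall>u \<in> coord_space n.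
          (\<forall>i \<in> {1..m}. \<bar>z i - a i\<bar> < r) \<longrightarrow> (\<forall>j \<in> {1..n}. \<bar>u j - b j\<bar> < r) \<longrightarrow>
          ((\<lambda>(k, l). c k l * monomial_at m a k z * monomial_at n b l u) has_sum g (z, u))
            (multi_indices m \<times> multi_indices n)"
    \<comment> \<open>The expansion is valid on the whole space, so the radius 1 is
      arbitrary.\<close>
    by (intro exI[of _ "1 :: real"] conjI exI[of _ ?d]) simp_all
qed

text \<open>Finiteness matters for the product over all words: over an infinite set it would be 1 by
  default and detect no exceptions.\<close>

lemma finite_words: "finite (words \<zeta> T)"
proof -
  have "words \<zeta> T \<subseteq> {\<alpha>. set \<alpha> \<subseteq> {1..\<zeta>} \<and> length \<alpha> \<le> T}"
    by (auto simp: words_def)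
  then show ?thesis
    using finite_lists_length_le[of "{1..\<zeta>}" T] finite_subset by blast
qed

lemma polynomial_at_word_sum:
  assumes "\<alpha> \<in> words m n"
  shows "polynomial_at m n a b (\<lambda>p. word_sum (fst p) (snd p) \<alpha>)"
  unfolding word_sum_def
proof (intro polynomial_at_sum polynomial_at_mult polynomial_at_fst polynomial_at_snd)
  fix t assume t: "t \<in> {1..length \<alpha>}"
  with assms show "t \<in> {1..n}" by (auto simp: words_def)
  from t have "\<alpha> ! (t - 1) \<in> set \<alpha>" by (intro nth_mem) auto
  with assms show "\<alpha> ! (t - 1) \<in> {1..m}" by (auto simp: words_def)
qed

text \<open>The lists are base \<open>B\<close> numerals, units digit first. Since the digit 0 is
  excluded, no numeral can be padded with zeros, and so lists of different lengths are separated
  too.\<close>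

lemma horner_sum_inject:
  fixes \<alpha> \<beta> :: "nat list"
  assumes "set \<alpha> \<subseteq> {1..<B}" "set \<beta> \<subseteq> {1..<B}" "horner_sum (\<lambda>x. x) B \<alpha> = horner_sum (\<lambda>x. x) B \<beta>"
  shows "\<alpha> = \<beta>"
  using assms
proof (induction \<alpha> arbitrary: \<beta>)
  case Nil
  then show ?case by (cases \<beta>) auto
next
  case (Cons x xs)
  then obtain y ys where \<beta>: "\<beta> = y # ys" by (cases \<beta>) auto
  have xy: "x < B" "y < B" using Cons.prems \<beta> by auto
  have eq: "x + B * horner_sum (\<lambda>x. x) B xs = y + B * horner_sum (\<lambda>x. x) B ys"
    using Cons.prems(3) by (simp add: \<beta>)
  \<comment> \<open>The units digit is the remainder modulo \<open>B\<close>.\<close>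
  have "x = y"
    using arg_cong[OF eq, of "\<lambda>k. k mod B"] xy by simp
  with eq xy have "horner_sum (\<lambda>x. x) B xs = horner_sum (\<lambda>x. x) B ys" by auto
  then have "xs = ys" using Cons.prems \<beta> by (intro Cons.IH) auto
  with \<beta> \<open>x = y\<close> show ?case by simp
qed

text \<open>Letter \<open>i\<close> has value \<open>i\<close> and position \<open>t\<close> has
  weight \<open>B ^ (t - 1)\<close>, so the first letter of the word is the units digit.\<close>

lemma word_sum_numeral:
  assumes "\<alpha> \<in> words \<zeta> T"
  shows "word_sum (\<lambda>i\<in>{1..\<zeta>}. real i) (\<lambda>t\<in>{1..T}. real B ^ (t - 1)) \<alpha>
    = real (horner_sum (\<lambda>x. x) B \<alpha>)"
proof -
  have len: "length \<alpha> \<le> T" and "set \<alpha> \<subseteq> {1..\<zeta>}"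
    using assms by (auto simp: words_def)
  then have letters: "\<alpha> ! t \<in> {1..\<zeta>}" if "t < length \<alpha>" for t
    using that nth_mem by blast
  have "word_sum (\<lambda>i\<in>{1..\<zeta>}. real i) (\<lambda>t\<in>{1..T}. real B ^ (t - 1)) \<alpha>
      = (\<Sum>t<length \<alpha>. (\<lambda>t\<in>{1..T}. real B ^ (t - 1)) (Suc t) * (\<lambda>i\<in>{1..\<zeta>}. real i) (\<alpha> ! t))"
    unfolding word_sum_def
    by (rule sum.reindex_bij_witness[of _ Suc "\<lambda>t. t - 1"]) auto
  also have "\<dots> = (\<Sum>t<length \<alpha>. real (\<alpha> ! t) * real B ^ t)"
    using len letters by (intro sum.cong) auto
  also have "\<dots> = real (horner_sum (\<lambda>x. x) B \<alpha>)"
    by (simp add: horner_sum_eq_sum atLeast0LessThan)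
  finally show ?thesis .
qed

text \<open>A word is nonempty and its first letter, the units digit, is at least 1.\<close>

lemma horner_sum_words_pos:
  assumes "\<alpha> \<in> words \<zeta> T"
  shows "horner_sum (\<lambda>x. x) B \<alpha> > (0 :: nat)"
  using assms by (cases \<alpha>) (auto simp: words_def)

theorem theorem22:
  fixes \<zeta> T :: nat
  shows "generic2 \<zeta> T (\<lambda>z u.
    word_sum z u \<in> words \<zeta> T \<rightarrow> UNIV - {0} \<and> inj_on (word_sum z u) (words \<zeta> T))"
proof -
  define W where "W = words \<zeta> T"
  define D where "D = {(\<alpha>, \<beta>) \<in> W \<times> W. \<alpha> \<noteq> \<beta>}"
  define s where "s p = word_sum (fst p) (snd p)" for p
  \<comment> \<open>If \<open>\<zeta>\<close> or \<open>T\<close> is 0, there are no words, both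
    products are empty and \<open>g\<close> is constantly 1.\<close>
  define g where "g p = (\<Prod>\<alpha>\<in>W. s p \<alpha>) * (\<Prod>q\<in>D. s p (fst q) - s p (snd q))" for p
  have finW: "finite W" unfolding W_def by (rule finite_words)
  have finD: "finite D" unfolding D_def
    by (rule finite_subset[of _ "W \<times> W"]) (use finW in auto)
  \<comment> \<open>A finite product of reals vanishes iff a factor does: the first product detects
    a zero value, the second a collision of two distinct words.\<close>
  have g_zero_iff: "g p = 0 \<longleftrightarrow> \<not> (s p \<in> W \<rightarrow> UNIV - {0} \<and> inj_on (s p) W)" for p
    using finW finD by (auto simp: g_def D_def inj_on_def)
  have "polynomial_at \<zeta> T a b g" for a b
    unfolding g_def s_def
    by (intro polynomial_at_mult polynomial_at_prod polynomial_at_diff polynomial_at_word_sum)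
      (auto simp: D_def W_def)
  then have "real_analytic2 \<zeta> T g"
    by (rule real_analytic2_if_polynomial)
  moreover
  \<comment> \<open>The base \<open>\<zeta> + 1\<close> exceeds every letter, so that the letters
    are nonzero digits.\<close>
  define p where "p = (\<lambda>i\<in>{1..\<zeta>}. real i, \<lambda>t\<in>{1..T}. real (\<zeta> + 1) ^ (t - 1))"
  have p: "p \<in> coord_space \<zeta> \<times> coord_space T"
    by (simp add: p_def coord_space_def)
  have sp: "s p \<alpha> = real (horner_sum (\<lambda>x. x) (\<zeta> + 1) \<alpha>)" if "\<alpha> \<in> W" for \<alpha>
    using word_sum_numeral[of \<alpha> \<zeta> T "\<zeta> + 1"] that by (simp only: s_def p_def W_def fst_conv snd_conv)
  have "s p \<in> W \<rightarrow> UNIV - {0}"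
    using horner_sum_words_pos[of _ \<zeta> T "\<zeta> + 1"] by (auto simp: sp W_def simp flip: W_def)
  moreover have "inj_on (s p) W"
  proof (rule inj_onI)
    fix \<alpha> \<beta> assume *: "\<alpha> \<in> W" "\<beta> \<in> W" "s p \<alpha> = s p \<beta>"
    then have "horner_sum (\<lambda>x. x) (\<zeta> + 1) \<alpha> = horner_sum (\<lambda>x. x) (\<zeta> + 1) \<beta>"
      by (simp only: sp of_nat_eq_iff)
    moreover have "set \<alpha> \<subseteq> {1..<\<zeta> + 1}" "set \<beta> \<subseteq> {1..<\<zeta> + 1}"
      using * by (auto simp: W_def words_def)
    ultimately show "\<alpha> = \<beta>" by (intro horner_sum_inject)
  qed
  ultimately have "g p \<noteq> 0" "real_analytic2 \<zeta> T g"
    by (simp_all add: g_zero_iff)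
  with p show ?thesis
    unfolding generic2_def by (intro exI[of _ g]) (auto simp only: g_zero_iff s_def W_def fst_conv snd_conv)
qed

end
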